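(* Let $0<\varepsilon<1$. Consider any Discoverer algorithm that solves the source detection game on trees, with consistent source behavior and unknown static graph, watching a single node per round, with success probability $p>0$. Then for every number of nodes $n$ there is an $n$-node instance on which the price of detection of that algorithm is at least $$\tfrac12\sqrt{\ln\!\big((1-p/(2+\varepsilon))^{-2}\big)}\; n\sqrt{n}.$$
   Context: A temporal graph $\mathcal{G}=(V,E,\lambda)$ with lifetime $T_{\max}$ consists of a finite simple undirected graph $(V,E)$, called the underlying static graph, together with a labeling $\lambda\colon E\to\{1,\dots,T_{\max}\}$. The edge $e$ is present only at time $\lambda(e)$. Write $n=|V|$. Infections follow the SIR model with duration $\delta\ge1$. A node may be seed-infected at some time. A susceptible node $u$ becomes infected at time $t$ iff some neighbor $v$ is infectious at time $t$ and $\lambda(uv)=t$; exactly one such neighbor counts as its infector. The node $u$ is then infectious at times $t+1,\dots,t+\delta$ and resistant afterwards. SD game: an Adversary fixes the temporal graph, $T_{\max}$, $\delta$, and a source node $s$. The Discoverer is told only $V$, $T_{\max}$ and $\delta$ (unknown static graph). In each round the Discoverer watches one node. All nodes start susceptible, the source is seed-infected, and an infection chain unfolds. The Discoverer learns whether, when, and by which neighbor the watched node was infected (or that it was the seed). Consistent source behavior means the same seed time and the same infection chain are used in every round. The Discoverer eventually names a node and wins iff it is $s$. The success probability is the probability of winning. The price of detection is the total number of nodes infected, summed over all rounds, until the Discoverer stops. "On trees" means the underlying static graph is a tree.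
   Formalization: The Discoverer must play at least one round before naming a node (else naming the only node at once for n=1 has price 0), and the price of a randomized algorithm is its worst case over its random choices (for the expected price the bound fails for small p). *)

theory Defs
  imports "HOL-Probability.Probability"
begin

section \<open>Temporal graphs\<close>

record temporal_graph =
  verts :: "nat set"
  edges :: "nat set set"
  label :: "nat set \<Rightarrow> nat"
  lifetime :: nat

definition temporal_graph :: "temporal_graph \<Rightarrow> bool" where
  "temporal_graph G \<longleftrightarrow>
     finite (verts G) \<and>
     (\<forall>e\<in>edges G. e \<subseteq> verts G \<and> card e = 2) \<and>
     (\<forall>e\<in>edges G. label G e \<in> {1..lifetime G})"

definition connected_graph :: "nat set \<Rightarrow> nat set set \<Rightarrow> bool" where
  "connected_graph V E \<longleftrightarrow>
     V \<noteq> {} \<and> (\<forall>u\<in>V. \<forall>v\<in>V. (u, v) \<in> {(x, y). {x, y} \<in> E}\<^sup>*)"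

definition graph_cycle :: "nat set set \<Rightarrow> nat list \<Rightarrow> bool" where
  "graph_cycle E c \<longleftrightarrow>
     length c \<ge> 3 \<and> distinct c \<and>
     (\<forall>i<length c. {c ! i, c ! (Suc i mod length c)} \<in> E)"

definition tree_graph :: "nat set \<Rightarrow> nat set set \<Rightarrow> bool" where
  "tree_graph V E \<longleftrightarrow> connected_graph V E \<and> (\<nexists>c. graph_cycle E c)"


section \<open>SIR infection chains\<close>

text \<open>The fate of a node is \<open>None\<close> if it is never infected, \<open>Some (t, None)\<close> if it is
  seed-infected at time \<open>t\<close>, and \<open>Some (t, Some v)\<close> if it is infected by \<open>v\<close> at time \<open>t\<close>.\<close>

type_synonym fate = "(nat \<times> nat option) option"
type_synonym chain = "nat \<Rightarrow> fate"

definition infected_at :: "chain \<Rightarrow> nat \<Rightarrow> nat \<Rightarrow> bool" where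
  "infected_at c u t \<longleftrightarrow> (\<exists>i. c u = Some (t, i))"

definition susceptible_at :: "chain \<Rightarrow> nat \<Rightarrow> nat \<Rightarrow> bool" where
  "susceptible_at c u t \<longleftrightarrow> \<not> (\<exists>t'<t. infected_at c u t')"

definition infectious_at :: "nat \<Rightarrow> chain \<Rightarrow> nat \<Rightarrow> nat \<Rightarrow> bool" where
  "infectious_at \<delta> c v t \<longleftrightarrow> (\<exists>t'. infected_at c v t' \<and> t \<in> {t' + 1..t' + \<delta>})"

definition can_infect :: "temporal_graph \<Rightarrow> nat \<Rightarrow> chain \<Rightarrow> nat \<Rightarrow> nat \<Rightarrow> nat \<Rightarrow> bool" where
  "can_infect G \<delta> c v u t \<longleftrightarrow>
     {u, v} \<in> edges G \<and> label G {u, v} = t \<and> infectious_at \<delta> c v t"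

text \<open>The infection chain is determined by \<open>s\<close> and \<open>t0\<close> up to the choice of infectors
  among simultaneous candidates, since \<open>can_infect\<close> at time \<open>t\<close> only depends on
  infections at times before \<open>t\<close>.\<close>

definition infection_chain ::
    "temporal_graph \<Rightarrow> nat \<Rightarrow> nat \<Rightarrow> nat \<Rightarrow> chain \<Rightarrow> bool" where
  "infection_chain G \<delta> s t0 c \<longleftrightarrow>
     c s = Some (t0, None) \<and>
     (\<forall>u. u \<notin> verts G \<longrightarrow> c u = None) \<and>
     (\<forall>u\<in>verts G - {s}. \<forall>t.
        (infected_at c u t \<longleftrightarrow>
           susceptible_at c u t \<and> (\<exists>v. can_infect G \<delta> c v u t)) \<and>
        (\<forall>i. c u = Some (t, i) \<longrightarrow> (\<exists>v. i = Some v \<and> can_infect G \<delta> c v u t)))"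


section \<open>The source detection game\<close>

text \<open>The Adversary's choice. With consistent source behavior the seed time and the
  infection chain are the same in every round, so they belong to the instance.\<close>

record sd_instance =
  graph :: temporal_graph
  duration :: nat
  source :: nat
  seed_time :: nat
  chain :: chain

definition sd_tree_instance :: "sd_instance \<Rightarrow> bool" where
  "sd_tree_instance I \<longleftrightarrow>
     temporal_graph (graph I) \<and>
     tree_graph (verts (graph I)) (edges (graph I)) \<and>
     duration I \<ge> 1 \<and>
     source I \<in> verts (graph I) \<and>
     seed_time I \<le> lifetime (graph I) \<and>
     infection_chain (graph I) (duration I) (source I) (seed_time I) (chain I)"

text \<open>The watched nodes and what was learned about them, in chronological order.\<close>

type_synonym history = "(nat \<times> fate) list"

text \<open>A randomized Discoverer knows the node set, the lifetime and the infection duration.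
  In each round it draws the node to watch from the history so far; after having learned
  the fate of this node it either goes on to another round (\<open>None\<close>) or stops and names a
  node.\<close>

record discoverer =
  watch :: "nat set \<Rightarrow> nat \<Rightarrow> nat \<Rightarrow> history \<Rightarrow> nat pmf"
  verdict :: "nat set \<Rightarrow> nat \<Rightarrow> nat \<Rightarrow> history \<Rightarrow> nat option pmf"

text \<open>The distribution of the named node and the final history, when the game is continued
  from the history \<open>h\<close>. The missing probability mass is the probability that the
  Discoverer never stops.\<close>

partial_function (spmf) play ::
    "discoverer \<Rightarrow> sd_instance \<Rightarrow> history \<Rightarrow> (nat \<times> history) spmf" where
  "play A I h =
     bind_pmf (watch A (verts (graph I)) (lifetime (graph I)) (duration I) h) (\<lambda>v.
     let h' = h @ [(v, chain I v)] in
     bind_pmf (verdict A (verts (graph I)) (lifetime (graph I)) (duration I) h') (\<lambda>d.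
     case d of None \<Rightarrow> play A I h' | Some x \<Rightarrow> return_spmf (x, h')))"

definition success_prob :: "discoverer \<Rightarrow> sd_instance \<Rightarrow> real" where
  "success_prob A I = spmf (map_spmf fst (play A I [])) (source I)"

definition solves_sd_on_trees :: "discoverer \<Rightarrow> real \<Rightarrow> bool" where
  "solves_sd_on_trees A p \<longleftrightarrow> (\<forall>I. sd_tree_instance I \<longrightarrow> success_prob A I \<ge> p)"

definition infected_nodes :: "sd_instance \<Rightarrow> nat set" where
  "infected_nodes I = {u \<in> verts (graph I). chain I u \<noteq> None}"

text \<open>The number of infected nodes, summed over the rounds of a play.\<close>

fun play_price :: "sd_instance \<Rightarrow> (nat \<times> history) option \<Rightarrow> ereal" where
  "play_price I None = \<infinity>"
| "play_price I (Some (x, h)) = ereal (real (\<Sum>_\<leftarrow>h. card (infected_nodes I)))"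

text \<open>The price of a randomized Discoverer is what it has to pay in the worst case over its
  random choices.\<close>

definition price_of_detection :: "discoverer \<Rightarrow> sd_instance \<Rightarrow> ereal" where
  "price_of_detection A I = (SUP r\<in>set_pmf (play A I []). play_price I r)"

end

theory Submission
  imports Defs "HOL-Combinatorics.Permutations"
begin

text \<open>
  If the price were always smaller, every play on an instance in which all \<open>n\<close> nodes get infected
  would end after at most \<open>k\<close> rounds, where \<open>2k\<^sup>2/n < - ln (1 - p / (2 + \<epsilon>))\<close>. Average the success
  probability over the temporal path \<open>\<pi> 0, \<pi> 1, \<dots>\<close> with source \<open>\<pi> 0\<close>, whose \<open>i\<close>-th edge has label
  \<open>i\<close>, for a uniformly random permutation \<open>\<pi>\<close>. Watching the node at position \<open>q\<close> reveals \<open>\<pi> q\<close> and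
  \<open>\<pi> (q - 1)\<close> and nothing else. With \<open>r\<close> rounds left, walking back along infectors reaches the
  source only from a known position \<open>\<le> r\<close>; as long as none is known and \<open>a\<close> positions are still
  unknown, the Discoverer wins with probability at most \<open>(r + 1) (r + 2) / (2 a)\<close>, by induction
  on \<open>r\<close>: a fresh node lies at one of the positions \<open>0, \<dots>, r\<close> with probability \<open>(r + 1) / a\<close>.
  Hence \<open>p \<le> (k + 1) (k + 2) / (2 n)\<close>, which contradicts \<open>p > 2 (1 - exp (- 2 k\<^sup>2 / n))\<close> unless
  \<open>n = 3\<close> and \<open>k = 1\<close>.

  On three nodes a path watched once always gives the source away. There, the source is placed
  at position 0 or 1 at random: the fate of the last node does not depend on this choice, so the
  Discoverer fails with probability at least 1/6.
\<close>

section \<open>Value of the game averaged over a set of instances\<close>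

lemma play_extends_history:
  "Some (x, h') \<in> set_pmf (play A I h) \<Longrightarrow> length h < length h'"
proof -
  have "\<forall>h. \<forall>y\<in>set_spmf (play A I h). length h < length (snd y)"
  proof (rule play.fixp_induct[where P = "\<lambda>f. \<forall>h. \<forall>y\<in>set_spmf (f A I h). length h < length (snd y)"], goal_cases)
    case 1
    then show ?case by simp
  next
    case 2
    then show ?case by simp
  next
    case (3 f)
    show ?case
    proof (intro allI ballI)
      fix h y
      assume "y \<in> set_spmf (bind_pmf (watch A (verts (graph I)) (lifetime (graph I)) (duration I) h) (\<lambda>v.
         let h' = h @ [(v, chain I v)] in
         bind_pmf (verdict A (verts (graph I)) (lifetime (graph I)) (duration I) h') (\<lambda>d.
         case d of None \<Rightarrow> f A I h' | Some x \<Rightarrow> return_spmf (x, h'))))"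
      then obtain v d where "y \<in> set_spmf (case d of None \<Rightarrow> f A I (h @ [(v, chain I v)])
          | Some x \<Rightarrow> return_spmf (x, h @ [(v, chain I v)]))"
        by (auto simp: in_set_spmf Let_def)
      with 3 show "length h < length (snd y)"
        by (cases d) fastforce+
    qed
  qed
  then show "length h < length h'" if "Some (x, h') \<in> set_pmf (play A I h)"
    using that by (metis in_set_spmf snd_conv)
qed

text \<open>\<open>win_bound I r S \<beta>\<close>: no strategy with at most \<open>r\<close> rounds wins on more than a fraction \<open>\<beta>\<close> of
  the instances in \<open>S\<close>. Watching \<open>v\<close> splits \<open>S\<close> into classes of equal fate of \<open>v\<close>, and \<open>\<rho>\<close> bounds the
  winning fraction on each class.\<close>

primrec win_bound :: "('i \<Rightarrow> sd_instance) \<Rightarrow> nat \<Rightarrow> 'i set \<Rightarrow> real \<Rightarrow> bool" where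
  "win_bound I 0 S \<beta> \<longleftrightarrow> (\<forall>x. real (card {i\<in>S. source (I i) = x}) \<le> \<beta> * card S)"
| "win_bound I (Suc r) S \<beta> \<longleftrightarrow>
     (\<forall>x. real (card {i\<in>S. source (I i) = x}) \<le> \<beta> * card S) \<and>
     (\<forall>v. \<exists>\<rho>. (\<forall>f\<in>(\<lambda>i. chain (I i) v) ` S. win_bound I r {i\<in>S. chain (I i) v = f} (\<rho> f)) \<and>
        (\<Sum>i\<in>S. \<rho> (chain (I i) v)) \<le> \<beta> * card S)"

lemma win_bound_guess:
  "win_bound I r S \<beta> \<Longrightarrow> real (card {i\<in>S. source (I i) = x}) \<le> \<beta> * card S"
  by (cases r) auto

lemma win_bound_one: "finite S \<Longrightarrow> win_bound I r S 1"
proof (induction r arbitrary: S)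
  case 0
  then show ?case by (auto intro!: card_mono)
next
  case (Suc r)
  then show ?case by (auto intro!: card_mono exI[of _ "\<lambda>_. 1"])
qed

lemma expectation_le_const:
  fixes g :: "'a \<Rightarrow> real"
  assumes "\<And>x. x \<in> set_pmf M \<Longrightarrow> 0 \<le> g x" "\<And>x. x \<in> set_pmf M \<Longrightarrow> g x \<le> b"
  shows "measure_pmf.expectation M g \<le> b"
proof -
  have "integrable (measure_pmf M) g"
    by (rule measure_pmf.integrable_const_bound[where B=b]) (auto simp: AE_measure_pmf_iff assms)
  then show ?thesis
    by (rule measure_pmf.integral_le_const) (auto simp: AE_measure_pmf_iff assms)
qed

lemma sum_expectation:
  fixes g :: "'i \<Rightarrow> 'a \<Rightarrow> real"
  assumes "\<And>i x. i \<in> S \<Longrightarrow> 0 \<le> g i x" "\<And>i x. i \<in> S \<Longrightarrow> g i x \<le> 1"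
  shows "(\<Sum>i\<in>S. measure_pmf.expectation M (g i)) = measure_pmf.expectation M (\<lambda>x. \<Sum>i\<in>S. g i x)"
proof (rule Bochner_Integration.integral_sum[symmetric])
  fix i assume "i \<in> S"
  then show "integrable (measure_pmf M) (g i)"
    by (intro measure_pmf.integrable_const_bound[where B=1]) (auto simp: assms)
qed

lemma play_step:
  fixes A :: discoverer and I :: sd_instance
  defines "W \<equiv> watch A (verts (graph I)) (lifetime (graph I)) (duration I)"
    and "D \<equiv> verdict A (verts (graph I)) (lifetime (graph I)) (duration I)"
  shows "spmf (map_spmf fst (play A I h)) x =
    measure_pmf.expectation (W h) (\<lambda>v. measure_pmf.expectation (D (h @ [(v, chain I v)])) 
      (case_option (spmf (map_spmf fst (play A I (h @ [(v, chain I v)]))) x) (\<lambda>y. of_bool (y = x))))"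
proof -
  have "map_spmf fst (play A I h) = 
     bind_pmf (W h) (\<lambda>v. bind_pmf (D (h @ [(v, chain I v)])) (\<lambda>d.
     case d of None \<Rightarrow> map_spmf fst (play A I (h @ [(v, chain I v)])) | Some x \<Rightarrow> return_spmf x))"
    by (subst play.simps)
       (auto simp: W_def D_def Let_def map_bind_pmf intro!: bind_pmf_cong split: option.splits)
  then show ?thesis
    by (auto simp: pmf_bind intro!: Bochner_Integration.integral_cong split: option.splits)
qed

lemma sum_success_le:
  fixes A :: discoverer and I :: "'i \<Rightarrow> sd_instance"
  assumes "win_bound I r S \<beta>" "finite S"
    and "\<And>i. i \<in> S \<Longrightarrow> verts (graph (I i)) = V"
    and "\<And>i. i \<in> S \<Longrightarrow> lifetime (graph (I i)) = T"
    and "\<And>i. i \<in> S \<Longrightarrow> duration (I i) = \<delta>"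
    and "\<And>i x h'. i \<in> S \<Longrightarrow> Some (x, h') \<in> set_pmf (play A (I i) h) \<Longrightarrow> length h' \<le> length h + r"
    and "\<And>i. i \<in> S \<Longrightarrow> None \<notin> set_pmf (play A (I i) h)"
  shows "(\<Sum>i\<in>S. spmf (map_spmf fst (play A (I i) h)) (source (I i))) \<le> \<beta> * card S"
  using assms
proof (induction r arbitrary: S h \<beta>)
  case 0
  have "S = {}"
  proof (rule ccontr)
    assume "S \<noteq> {}"
    then obtain i where "i \<in> S" by blast
    moreover obtain y where y: "y \<in> set_pmf (play A (I i) h)"
      using set_pmf_not_empty[of "play A (I i) h"] by blast
    ultimately obtain x h' where "y = Some (x, h')"
      using "0.prems"(7) by (cases y) auto
    with y \<open>i \<in> S\<close> "0.prems"(6) play_extends_history show False by fastforce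
  qed
  then show ?case by simp
next
  case (Suc r)
  let ?W = "watch A V T \<delta>" and ?D = "verdict A V T \<delta>"
  let ?h = "\<lambda>i v. h @ [(v, chain (I i) v)]"
  define \<sigma> where "\<sigma> i h = spmf (map_spmf fst (play A (I i) h)) (source (I i))" for i h
  define \<phi> where "\<phi> i f v = measure_pmf.expectation (?D (h @ [(v, f)]))
      (case_option (\<sigma> i (h @ [(v, f)])) (\<lambda>y. of_bool (y = source (I i))))" for i f v
  have \<sigma>01: "0 \<le> \<sigma> i h" "\<sigma> i h \<le> 1" for i h
    by (auto simp: \<sigma>_def pmf_le_1)
  have case01: "0 \<le> case_option (\<sigma> i h) (\<lambda>y. of_bool (y = source (I i))) d"
    "case_option (\<sigma> i h) (\<lambda>y. of_bool (y = source (I i))) d \<le> 1" for i h d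
    using \<sigma>01 by (auto split: option.splits)
  have \<phi>01: "0 \<le> \<phi> i f v" "\<phi> i f v \<le> 1" for i f v
    unfolding \<phi>_def
    by (auto intro!: Bochner_Integration.integral_nonneg expectation_le_const case01)
  have "(\<Sum>i\<in>S. \<sigma> i h) = (\<Sum>i\<in>S. measure_pmf.expectation (?W h) (\<lambda>v. \<phi> i (chain (I i) v) v))"
    unfolding \<sigma>_def \<phi>_def using Suc.prems by (intro sum.cong refl) (subst play_step, simp)
  also have "\<dots> = measure_pmf.expectation (?W h) (\<lambda>v. \<Sum>i\<in>S. \<phi> i (chain (I i) v) v)"
    by (rule sum_expectation) (auto simp: \<phi>01)
  also have "\<dots> \<le> \<beta> * card S"
  proof (rule expectation_le_const)
    fix v assume v: "v \<in> set_pmf (?W h)"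
    from Suc.prems(1) obtain \<rho> where
      \<rho>: "\<And>f. f \<in> (\<lambda>i. chain (I i) v) ` S \<Longrightarrow> win_bound I r {i\<in>S. chain (I i) v = f} (\<rho> f)"
      and sum_\<rho>: "(\<Sum>i\<in>S. \<rho> (chain (I i) v)) \<le> \<beta> * card S"
      unfolding win_bound.simps by blast
    have "(\<Sum>i\<in>S. \<phi> i (chain (I i) v) v) =
        (\<Sum>f\<in>(\<lambda>i. chain (I i) v) ` S. \<Sum>i\<in>{i\<in>S. chain (I i) v = f}. \<phi> i (chain (I i) v) v)"
      by (rule sum.image_gen[OF \<open>finite S\<close>])
    also have "\<dots> \<le> (\<Sum>f\<in>(\<lambda>i. chain (I i) v) ` S. \<Sum>i\<in>{i\<in>S. chain (I i) v = f}. \<rho> (chain (I i) v))"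
    proof (rule sum_mono)
      fix f assume f: "f \<in> (\<lambda>i. chain (I i) v) ` S"
      let ?S = "{i\<in>S. chain (I i) v = f}" and ?h = "h @ [(v, f)]"
      have "(\<Sum>i\<in>?S. \<phi> i (chain (I i) v) v) = (\<Sum>i\<in>?S. \<phi> i f v)"
        by (rule sum.cong) auto
      also have "\<dots> = measure_pmf.expectation (?D ?h) (\<lambda>d. \<Sum>i\<in>?S.
          case_option (\<sigma> i ?h) (\<lambda>y. of_bool (y = source (I i))) d)"
        unfolding \<phi>_def by (rule sum_expectation) (auto simp: case01)
      also have "\<dots> \<le> \<rho> f * card ?S"
      proof (rule expectation_le_const)
        fix d assume d: "d \<in> set_pmf (?D ?h)"
        show "(\<Sum>i\<in>?S. case_option (\<sigma> i ?h) (\<lambda>y. of_bool (y = source (I i))) d) \<le> \<rho> f * card ?S"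
        proof (cases d)
          case None
          have sub: "set_pmf (play A (I i) ?h) \<subseteq> set_pmf (play A (I i) h)" if "i \<in> ?S" for i
            using that v d Suc.prems(3-5) None
            by (subst (2) play.simps) (force simp: Let_def)
          have "(\<Sum>i\<in>?S. spmf (map_spmf fst (play A (I i) ?h)) (source (I i))) \<le> \<rho> f * card ?S"
          proof (rule Suc.IH[OF \<rho>[OF f]])
            fix i x h' assume "i \<in> ?S" "Some (x, h') \<in> set_pmf (play A (I i) ?h)"
            with sub Suc.prems(6)[of i x h'] show "length h' \<le> length ?h + r" by auto
          next
            fix i assume "i \<in> ?S"
            with sub Suc.prems(7)[of i] show "None \<notin> set_pmf (play A (I i) ?h)" by auto
          qed (use Suc.prems in auto)
          with None show ?thesis by (simp add: \<sigma>_def)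
        next
          case (Some x)
          have "(\<Sum>i\<in>?S. of_bool (x = source (I i))) = real (card {i\<in>?S. source (I i) = x})"
            using \<open>finite S\<close> by (simp add: of_bool_def sum.If_cases Int_def conj_ac eq_commute)
          with Some win_bound_guess[OF \<rho>[OF f], of x] show ?thesis by simp
        qed
      qed (auto intro!: sum_nonneg case01)
      also have "\<dots> = (\<Sum>i\<in>?S. \<rho> (chain (I i) v))"
        by simp
      finally show "(\<Sum>i\<in>?S. \<phi> i (chain (I i) v) v) \<le> (\<Sum>i\<in>?S. \<rho> (chain (I i) v))" .
    qed
    also have "\<dots> = (\<Sum>i\<in>S. \<rho> (chain (I i) v))"
      by (rule sum.image_gen[OF \<open>finite S\<close>, symmetric])
    finally show "(\<Sum>i\<in>S. \<phi> i (chain (I i) v) v) \<le> \<beta> * card S"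
      using sum_\<rho> by simp
  qed (auto intro!: sum_nonneg \<phi>01)
  finally show ?case by (simp add: \<sigma>_def)
qed

section \<open>Temporal paths\<close>

lemma infection_chainI:
  assumes "c s = Some (t0, None)" "\<And>u. u \<notin> verts G \<Longrightarrow> c u = None"
    and inf: "\<And>u. u \<in> verts G - {s} \<Longrightarrow> \<exists>t v. c u = Some (t, Some v) \<and> can_infect G \<delta> c v u t \<and>
      (\<forall>t'<t. \<forall>v'. \<not> can_infect G \<delta> c v' u t')"
  shows "infection_chain G \<delta> s t0 c"
  unfolding infection_chain_def
proof (intro conjI ballI allI impI assms(1,2))
  fix u t assume "u \<in> verts G - {s}"
  then obtain t1 v where u: "c u = Some (t1, Some v)" "can_infect G \<delta> c v u t1"
    and min: "\<And>t' v'. t' < t1 \<Longrightarrow> \<not> can_infect G \<delta> c v' u t'"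
    using inf by blast
  have "infected_at c u t' \<longleftrightarrow> t' = t1" for t'
    using u by (auto simp: infected_at_def)
  then show "infected_at c u t \<longleftrightarrow> susceptible_at c u t \<and> (\<exists>v. can_infect G \<delta> c v u t)"
    using u(2) min by (auto simp: susceptible_at_def not_less order.order_iff_strict)
  show "\<exists>v. i = Some v \<and> can_infect G \<delta> c v u t" if "c u = Some (t, i)" for i
    using u that by auto
qed

definition path_graph :: "nat \<Rightarrow> (nat \<Rightarrow> nat) \<Rightarrow> temporal_graph" where
  "path_graph n \<pi> = \<lparr>verts = {..<n}, edges = {{\<pi> i, \<pi> (Suc i)} |i. Suc i < n},
     label = (\<lambda>e. Max (inv \<pi> ` e)), lifetime = n\<rparr>"

text \<open>The source is at position \<open>s\<close>, which is 0 or 1. Its seed time is 0, and the duration 2 lets a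
  source at position 1 infect both of its neighbours.\<close>

definition path_chain :: "nat \<Rightarrow> nat \<Rightarrow> (nat \<Rightarrow> nat) \<Rightarrow> chain" where
  "path_chain n s \<pi> u =
     (if u < n then
        let j = inv \<pi> u in
          if j = s then Some (0, None) else Some (max 1 j, Some (\<pi> (if j = 0 then 1 else j - 1)))
      else None)"

definition path_instance :: "nat \<Rightarrow> nat \<Rightarrow> (nat \<Rightarrow> nat) \<Rightarrow> sd_instance" where
  "path_instance n s \<pi> = \<lparr>graph = path_graph n \<pi>, duration = 2, source = \<pi> s, seed_time = 0,
     chain = path_chain n s \<pi>\<rparr>"

lemma path_instance_sel [simp]:
  "verts (graph (path_instance n s \<pi>)) = {..<n}"
  "lifetime (graph (path_instance n s \<pi>)) = n"
  "duration (path_instance n s \<pi>) = 2"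
  "source (path_instance n s \<pi>) = \<pi> s"
  "chain (path_instance n s \<pi>) = path_chain n s \<pi>"
  by (simp_all add: path_instance_def path_graph_def)

context
  fixes n :: nat and \<pi> :: "nat \<Rightarrow> nat"
  assumes \<pi>: "\<pi> permutes {..<n}"
begin

lemma path_perm_less [simp]: "\<pi> j < n \<longleftrightarrow> j < n"
  using permutes_in_image[OF \<pi>, of j] by simp

lemma path_inv_less [simp]: "inv \<pi> u < n \<longleftrightarrow> u < n"
  using permutes_in_image[OF permutes_inv[OF \<pi>], of u] by simp

lemma path_perm_eq [simp]: "\<pi> i = \<pi> j \<longleftrightarrow> i = j"
  using permutes_inj[OF \<pi>] by (simp add: inj_eq)

lemma path_edge_iff:
  "{\<pi> i, \<pi> j} \<in> edges (path_graph n \<pi>) \<longleftrightarrow> i < n \<and> j < n \<and> (j = Suc i \<or> i = Suc j)"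
  by (auto simp: path_graph_def doubleton_eq_iff)

lemma path_vertexE:
  assumes "u < n" obtains j where "u = \<pi> j" "j < n"
  using that[of "inv \<pi> u"] assms by (simp add: permutes_inverses(1)[OF \<pi>])

lemma path_label: "label (path_graph n \<pi>) {\<pi> i, \<pi> j} = max i j"
  by (simp add: path_graph_def permutes_inverses(2)[OF \<pi>])

lemma temporal_graph_path: "temporal_graph (path_graph n \<pi>)"
proof -
  have "e \<subseteq> {..<n} \<and> card e = 2 \<and> label (path_graph n \<pi>) e \<in> {1..n}"
    if e: "e \<in> edges (path_graph n \<pi>)" for e
  proof -
    obtain i where "e = {\<pi> i, \<pi> (Suc i)}" "Suc i < n"
      using e by (auto simp: path_graph_def)
    then show ?thesis by (simp add: path_label)
  qed
  then show ?thesis by (simp add: temporal_graph_def) (simp add: path_graph_def)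
qed

lemma tree_graph_path:
  assumes "n \<ge> 1"
  shows "tree_graph {..<n} (edges (path_graph n \<pi>))"
  unfolding tree_graph_def connected_graph_def
proof (intro conjI ballI notI)
  show "False" if "{..<n} = {}" using assms that by (simp add: lessThan_empty_iff)
next
  let ?R = "{(x, y). {x, y} \<in> edges (path_graph n \<pi>)}"
  have from0: "(\<pi> 0, \<pi> j) \<in> ?R\<^sup>*" if "j < n" for j
    using that
  proof (induction j)
    case (Suc j)
    then have "(\<pi> j, \<pi> (Suc j)) \<in> ?R" by (simp add: path_edge_iff)
    with Suc show ?case by (meson Suc_lessD rtrancl.rtrancl_into_rtrancl)
  qed simp
  have sym: "sym (?R\<^sup>*)"
    by (intro sym_rtrancl symI) (auto simp: insert_commute)
  fix u v assume "u \<in> {..<n}" "v \<in> {..<n}"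
  then obtain i j where "u = \<pi> i" "i < n" "v = \<pi> j" "j < n"
    using path_vertexE by (metis lessThan_iff)
  with symD[OF sym from0] from0 show "(u, v) \<in> ?R\<^sup>*"
    by (auto intro: rtrancl_trans)
next
  assume "\<exists>c. graph_cycle (edges (path_graph n \<pi>)) c"
  then obtain c where len: "length c \<ge> 3" and dist: "distinct c"
    and edge: "\<And>i. i < length c \<Longrightarrow> {c ! i, c ! (Suc i mod length c)} \<in> edges (path_graph n \<pi>)"
    by (auto simp: graph_cycle_def)
  define pos where "pos i = inv \<pi> (c ! i)" for i
  let ?l = "length c"
  have c: "c ! i = \<pi> (pos i)" for i
    by (simp add: pos_def permutes_inverses(1)[OF \<pi>])
  have adj: "pos (Suc i mod ?l) = Suc (pos i) \<or> pos i = Suc (pos (Suc i mod ?l))" if "i < ?l" for i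
    using edge[OF that] by (auto simp: c path_edge_iff)
  have inj: "i = j" if "i < ?l" "j < ?l" "pos i = pos j" for i j
    using that dist by (metis c nth_eq_iff_index_eq)
  have "finite (pos ` {..<?l})" "pos ` {..<?l} \<noteq> {}"
    using len by (auto simp: lessThan_empty_iff)
  from Max_in[OF this] Max_ge[OF this(1)]
  obtain m where m: "m < ?l" "\<And>i. i < ?l \<Longrightarrow> pos i \<le> pos m"
    by (metis imageE imageI lessThan_iff)
  \<comment> \<open>Both cycle neighbours of the vertex furthest along the path must precede it directly.\<close>
  define q where "q = (if m = 0 then ?l - 1 else m - 1)"
  have q: "q < ?l" "Suc q mod ?l = m"
    using m(1) len by (auto simp: q_def)
  have s: "Suc m mod ?l < ?l" "q \<noteq> Suc m mod ?l"
    using m(1) len by (auto simp: q_def mod_Suc)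
  have "pos (Suc m mod ?l) = pos q"
    using adj[OF m(1)] adj[OF q(1)] m(2)[OF q(1)] m(2)[OF s(1)] q(2) by auto
  with inj[OF s(1) q(1)] s(2) show False by simp
qed

lemma path_chain_perm:
  "path_chain n s \<pi> (\<pi> j) = (if j < n then
     if j = s then Some (0, None) else Some (max 1 j, Some (\<pi> (if j = 0 then 1 else j - 1))) else None)"
  by (simp add: path_chain_def permutes_inverses(2)[OF \<pi>])

lemma infection_chain_path:
  assumes "s \<le> 1" "s < n"
  shows "infection_chain (path_graph n \<pi>) 2 (\<pi> s) 0 (path_chain n s \<pi>)"
proof (rule infection_chainI)
  show "path_chain n s \<pi> (\<pi> s) = Some (0, None)"
    using assms by (simp add: path_chain_perm)
  show "path_chain n s \<pi> u = None" if "u \<notin> verts (path_graph n \<pi>)" for u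
    using that by (simp add: path_chain_def path_graph_def)
  fix u assume "u \<in> verts (path_graph n \<pi>) - {\<pi> s}"
  then have "u < n" "u \<noteq> \<pi> s" by (auto simp: path_graph_def)
  then obtain j where j: "u = \<pi> j" "j < n" "j \<noteq> s"
    by (metis path_vertexE)
  define k where "k = (if j = 0 then 1 else j - 1)"
  have k: "k < n" "j = Suc k \<or> k = Suc j" "max j k = max 1 j"
    using j assms by (auto simp: k_def)
  have "infectious_at 2 (path_chain n s \<pi>) (\<pi> k) (max 1 j)"
    using j assms k by (auto simp: infectious_at_def infected_at_def path_chain_perm k_def)
  moreover have "{\<pi> j, \<pi> k} \<in> edges (path_graph n \<pi>)" "label (path_graph n \<pi>) {\<pi> j, \<pi> k} = max 1 j"
    using j k by (auto simp: path_edge_iff path_label)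
  ultimately have "can_infect (path_graph n \<pi>) 2 (path_chain n s \<pi>) (\<pi> k) u (max 1 j)"
    by (simp add: can_infect_def j(1))
  moreover have "\<not> can_infect (path_graph n \<pi>) 2 (path_chain n s \<pi>) v u t" if "t < max 1 j" for t v
  proof
    assume v: "can_infect (path_graph n \<pi>) 2 (path_chain n s \<pi>) v u t"
    have "v = \<pi> (inv \<pi> v)" by (simp add: permutes_inverses(1)[OF \<pi>])
    then obtain i where i: "v = \<pi> i" ..
    with v have "{\<pi> j, \<pi> i} \<in> edges (path_graph n \<pi>)" "max j i = t"
      by (auto simp: can_infect_def j(1) path_label)
    then show False using that by (auto simp: path_edge_iff)
  qed
  ultimately show "\<exists>t v. path_chain n s \<pi> u = Some (t, Some v) \<and>
      can_infect (path_graph n \<pi>) 2 (path_chain n s \<pi>) v u t \<and>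
      (\<forall>t'<t. \<forall>v'. \<not> can_infect (path_graph n \<pi>) 2 (path_chain n s \<pi>) v' u t')"
    using j by (intro exI[of _ "max 1 j"] exI[of _ "\<pi> k"])
      (simp add: path_chain_perm k_def)
qed

lemma sd_tree_instance_path:
  assumes "s \<le> 1" "s < n"
  shows "sd_tree_instance (path_instance n s \<pi>)"
  using assms temporal_graph_path tree_graph_path infection_chain_path[OF assms]
  unfolding sd_tree_instance_def path_instance_sel
  by (simp add: path_instance_def path_graph_def)

lemma infected_nodes_path: "infected_nodes (path_instance n s \<pi>) = {..<n}"
  by (auto simp: infected_nodes_def path_chain_def Let_def)

end

section \<open>Random paths\<close>

text \<open>The permutations consistent with a history: \<open>D\<close> is the set of positions revealed so far.\<close>

definition agreeing :: "nat \<Rightarrow> nat set \<Rightarrow> (nat \<Rightarrow> nat) \<Rightarrow> (nat \<Rightarrow> nat) set" where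
  "agreeing n D \<pi>0 = {\<pi>. \<pi> permutes {..<n} \<and> (\<forall>j\<in>D. \<pi> j = \<pi>0 j)}"

lemma finite_agreeing [simp]: "finite (agreeing n D \<pi>0)"
  by (rule finite_subset[OF _ finite_permutations[of "{..<n}"]]) (auto simp: agreeing_def)

lemma card_agreeing:
  assumes "\<pi>0 permutes {..<n}" "D \<subseteq> {..<n}"
  shows "card (agreeing n D \<pi>0) = fact (n - card D)"
proof -
  have "bij_betw ((\<circ>) \<pi>0) {\<sigma>. \<sigma> permutes ({..<n} - D)} (agreeing n D \<pi>0)"
  proof (rule bij_betwI[where g = "(\<circ>) (inv \<pi>0)"])
    show "(\<circ>) \<pi>0 \<in> {\<sigma>. \<sigma> permutes ({..<n} - D)} \<rightarrow> agreeing n D \<pi>0"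
      using assms(1) by (auto simp: agreeing_def permutes_not_in
          intro!: permutes_compose dest: permutes_subset[of _ _ "{..<n}"])
    show "(\<circ>) (inv \<pi>0) \<in> agreeing n D \<pi>0 \<rightarrow> {\<sigma>. \<sigma> permutes ({..<n} - D)}"
    proof (intro funcsetI CollectI)
      fix \<pi> assume \<pi>: "\<pi> \<in> agreeing n D \<pi>0"
      show "inv \<pi>0 \<circ> \<pi> permutes ({..<n} - D)"
      proof (rule permutes_superset[where S = "{..<n}"])
        show "inv \<pi>0 \<circ> \<pi> permutes {..<n}"
          using \<pi> assms(1) by (auto simp: agreeing_def intro!: permutes_compose permutes_inv)
      qed (use \<pi> assms in \<open>auto simp: agreeing_def permutes_inverses\<close>)
    qed
  qed (use assms(1) in \<open>auto simp: fun_eq_iff permutes_inverses\<close>)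
  then have "card (agreeing n D \<pi>0) = card {\<sigma>. \<sigma> permutes ({..<n} - D)}"
    by (simp add: bij_betw_same_card)
  also have "\<dots> = fact (card ({..<n} - D))"
    by (rule card_permutations) auto
  finally show ?thesis
    using assms(2) by (simp add: card_Diff_subset finite_subset)
qed

lemma card_agreeing_at:
  assumes "\<pi>0 permutes {..<n}" "D \<subseteq> {..<n}" "q < n" "q \<notin> D" "x < n" "x \<notin> \<pi>0 ` D"
  shows "card {\<pi>\<in>agreeing n D \<pi>0. \<pi> q = x} = fact (n - card D - 1)"
proof -
  define \<pi>1 where "\<pi>1 = \<pi>0 \<circ> Transposition.transpose q (inv \<pi>0 x)"
  have "\<pi>0 (inv \<pi>0 x) = x"
    by (simp add: permutes_inverses[OF assms(1)])
  with assms have x: "inv \<pi>0 x < n" "inv \<pi>0 x \<notin> D" "\<pi>0 (inv \<pi>0 x) = x"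
    by (auto simp: image_iff)
  then have \<pi>1: "\<pi>1 permutes {..<n}"
    unfolding \<pi>1_def using assms by (intro permutes_compose permutes_swap_id) auto
  have "{\<pi>\<in>agreeing n D \<pi>0. \<pi> q = x} = agreeing n (insert q D) \<pi>1"
    using x assms(4) by (auto simp: agreeing_def \<pi>1_def Transposition.transpose_def)
  also have "card \<dots> = fact (n - card (insert q D))"
    using \<pi>1 assms by (intro card_agreeing) auto
  finally show ?thesis
    using assms finite_subset[OF assms(2)] by simp
qed

lemma card_agreeing_at_le:
  assumes "\<pi>0 permutes {..<n}" "D \<subseteq> {..<n}" "q < n" "q \<notin> D"
  shows "real (card {\<pi>\<in>agreeing n D \<pi>0. \<pi> q = x}) * real (n - card D) \<le> real (card (agreeing n D \<pi>0))"
proof (cases "x < n \<and> x \<notin> \<pi>0 ` D")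
  case True
  have "card D < card {..<n}"
    using assms by (intro psubset_card_mono) auto
  then have "n - card D = Suc (n - card D - 1)" by simp
  then have "fact (n - card D) = real (n - card D) * fact (n - card D - 1)"
    by (metis fact_Suc)
  with True show ?thesis
    using card_agreeing_at[OF assms] card_agreeing[OF assms(1,2)] by simp
next
  case False
  have "\<pi> q \<noteq> x" if "\<pi> \<in> agreeing n D \<pi>0" for \<pi>
  proof
    assume eq: "\<pi> q = x"
    have perm: "\<pi> permutes {..<n}" and agr: "\<And>j. j \<in> D \<Longrightarrow> \<pi> j = \<pi>0 j"
      using that by (auto simp: agreeing_def)
    have "x < n" using eq perm assms(3) by auto
    with False obtain j where "j \<in> D" "x = \<pi>0 j" by blast
    with eq agr have "\<pi> q = \<pi> j" by simp
    with perm \<open>j \<in> D\<close> assms(4) show False by auto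
  qed
  then have "{\<pi>\<in>agreeing n D \<pi>0. \<pi> q = x} = {}" by blast
  then show ?thesis by (simp only: card.empty)
qed

lemma path_chain_start:
  assumes "\<pi> permutes {..<n}" "v < n"
  shows "path_chain n 0 \<pi> v = Some (inv \<pi> v, if inv \<pi> v = 0 then None else Some (\<pi> (inv \<pi> v - 1)))"
  using assms by (auto simp: path_chain_def Let_def max_def)

lemma agreeing_same_fate:
  assumes "\<pi>1 \<in> agreeing n D \<pi>0" "v < n"
  defines "q \<equiv> inv \<pi>1 v"
  shows "{\<pi>\<in>agreeing n D \<pi>0. path_chain n 0 \<pi> v = path_chain n 0 \<pi>1 v} = agreeing n (D \<union> {q, q - 1}) \<pi>1"
proof -
  have \<pi>1: "\<pi>1 permutes {..<n}" "\<And>j. j \<in> D \<Longrightarrow> \<pi>1 j = \<pi>0 j"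
    using assms(1) by (auto simp: agreeing_def)
  have v: "\<pi>1 q = v" by (simp add: q_def permutes_inverses[OF \<pi>1(1)])
  have "path_chain n 0 \<pi> v = path_chain n 0 \<pi>1 v \<longleftrightarrow> (\<forall>j\<in>{q, q - 1}. \<pi> j = \<pi>1 j)"
    if \<pi>: "\<pi> permutes {..<n}" for \<pi>
  proof -
    have "inv \<pi> v = q \<longleftrightarrow> \<pi> q = v"
      by (rule permutes_inv_eq[OF \<pi>])
    then show ?thesis
      unfolding path_chain_start[OF \<pi> assms(2)] path_chain_start[OF \<pi>1(1) assms(2)] q_def[symmetric]
      using v by auto
  qed
  then show ?thesis using \<pi>1(2) by (auto simp: agreeing_def)
qed

lemma win_bound_path:
  assumes "\<pi>0 permutes {..<n}" "D \<subseteq> {r<..<n}" "r < n"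
  shows "win_bound (path_instance n 0) r (agreeing n D \<pi>0)
    (real ((r + 1) * (r + 2)) / 2 / real (n - card D))"
  using assms
proof (induction r arbitrary: \<pi>0 D)
  case 0
  then have "D \<subset> {..<n}" "0 \<notin> D" by auto
  then have "D \<subseteq> {..<n}" "0 \<notin> D" "card D < n"
    using psubset_card_mono[of "{..<n}" D] by auto
  then have "real (card {\<pi>\<in>agreeing n D \<pi>0. \<pi> 0 = x}) * real (n - card D) \<le> real (card (agreeing n D \<pi>0))" for x
    using 0 by (intro card_agreeing_at_le) auto
  with \<open>card D < n\<close> show ?case by (simp add: field_simps)
next
  case (Suc r)
  let ?S = "agreeing n D \<pi>0"
  define a where "a = n - card D"
  define C where "C = real ((r + 1) * (r + 2)) / 2"
  define C' where "C' = real ((Suc r + 1) * (Suc r + 2)) / 2"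
  have "0 < C" unfolding C_def by (simp del: of_nat_mult)
  moreover have "C' = C + (r + 2)" by (simp add: C_def C'_def field_simps)
  ultimately have C: "0 < C" "C' = C + (r + 2)" "C + 2 \<le> C'" by auto
  have D: "D \<subseteq> {..<n}" "finite D" using Suc.prems(2) by (auto intro: finite_subset)
  have "D \<union> {..Suc r} \<subseteq> {..<n}" "D \<inter> {..Suc r} = {}"
    using Suc.prems(2,3) by auto
  then have "card D + (r + 2) \<le> n"
    using card_mono[of "{..<n}" "D \<union> {..Suc r}"] D(2) by (simp add: card_Un_disjoint)
  then have a: "a \<ge> r + 2" by (simp add: a_def)
  have cardS: "real (card ?S) = a * fact (a - 1)"
    using card_agreeing[OF Suc.prems(1) D(1)] a by (simp add: a_def[symmetric] fact_reduce)
  have "win_bound (path_instance n 0) (Suc r) ?S (C' / a)"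
    unfolding win_bound.simps path_instance_sel
  proof (intro conjI allI)
    fix x
    have "real (card {\<pi>\<in>?S. \<pi> 0 = x}) * real a \<le> real (card ?S)"
      unfolding a_def using Suc.prems D by (intro card_agreeing_at_le) auto
    also have "\<dots> \<le> C' * card ?S"
      using C by (intro mult_le_cancel_right1[THEN iffD2]) auto
    finally show "real (card {\<pi>\<in>?S. \<pi> 0 = x}) \<le> C' / a * card ?S"
      using a by (simp add: field_simps)
  next
    fix v
    show "\<exists>\<rho>. (\<forall>f\<in>(\<lambda>\<pi>. path_chain n 0 \<pi> v) ` ?S.
            win_bound (path_instance n 0) r {\<pi>\<in>?S. path_chain n 0 \<pi> v = f} (\<rho> f)) \<and>
          (\<Sum>\<pi>\<in>?S. \<rho> (path_chain n 0 \<pi> v)) \<le> C' / a * card ?S"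
    proof (cases "v < n")
      case False
      then have "path_chain n 0 \<pi> v = None" for \<pi> by (simp add: path_chain_def)
      moreover have "win_bound (path_instance n 0) r ?S (C / a)"
        unfolding C_def a_def using Suc.prems by (intro Suc.IH) auto
      moreover have "C / a \<le> C' / a" using C by (simp add: divide_right_mono)
      ultimately show ?thesis
        using mult_right_mono[of "C / a" "C' / a" "real (card ?S)"]
        by (intro exI[of _ "\<lambda>_. C / a"]) (auto simp: mult.commute)
    next
      case True
      define \<rho> where "\<rho> f = (case f of None \<Rightarrow> 1 | Some (q, u) \<Rightarrow>
        if q \<le> r + 1 then 1 else C / real (n - card (D \<union> {q, q - 1})))" for f :: fate
      have \<rho>_eq: "\<rho> (path_chain n 0 \<pi> v) = (if inv \<pi> v \<le> r + 1 then 1 else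
          C / real (n - card (D \<union> {inv \<pi> v, inv \<pi> v - 1})))" if "\<pi> \<in> ?S" for \<pi>
        using that path_chain_start[of \<pi> n v] True by (simp add: agreeing_def \<rho>_def)
      have "win_bound (path_instance n 0) r {\<pi>\<in>?S. path_chain n 0 \<pi> v = f} (\<rho> f)"
        if f: "f \<in> (\<lambda>\<pi>. path_chain n 0 \<pi> v) ` ?S" for f
      proof -
        from f obtain \<pi>1 where \<pi>1: "\<pi>1 \<in> ?S" "f = path_chain n 0 \<pi>1 v" by blast
        define q where "q = inv \<pi>1 v"
        have "q < n"
          using \<pi>1(1) True by (auto simp: agreeing_def q_def)
        show ?thesis
        proof (cases "q \<le> r + 1")
          case True
          then show ?thesis
            using \<pi>1 by (simp add: \<rho>_eq q_def win_bound_one)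
        next
          case False
          have "win_bound (path_instance n 0) r (agreeing n (D \<union> {q, q - 1}) \<pi>1)
              (C / real (n - card (D \<union> {q, q - 1})))"
            unfolding C_def using Suc.prems False \<open>q < n\<close> \<pi>1(1)
            by (intro Suc.IH) (auto simp: agreeing_def)
          then show ?thesis
            using False agreeing_same_fate[OF \<pi>1(1) \<open>v < n\<close>] \<rho>_eq[OF \<pi>1(1)]
            unfolding \<pi>1(2) q_def by simp
        qed
      qed
      moreover have "(\<Sum>\<pi>\<in>?S. \<rho> (path_chain n 0 \<pi> v)) \<le> C' / a * card ?S"
      proof (cases "v \<in> \<pi>0 ` D")
        case True
        then obtain q where q: "q \<in> D" "v = \<pi>0 q" by blast
        have "\<rho> (path_chain n 0 \<pi> v) \<le> C' / a" if \<pi>: "\<pi> \<in> ?S" for \<pi>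
        proof -
          have perm: "\<pi> permutes {..<n}" and "\<pi> q = v"
            using \<pi> q by (auto simp: agreeing_def)
          then have inv: "inv \<pi> v = q" by (simp add: permutes_inv_eq)
          have "D \<union> {q, q - 1} = insert (q - 1) D" using q by auto
          then have "card (D \<union> {q, q - 1}) \<le> card D + 1"
            using D(2) by (simp add: card_insert_if)
          then have "C / real (n - card (D \<union> {q, q - 1})) \<le> C / real (a - 1)"
            using a C by (intro divide_left_mono) (auto simp: a_def)
          also have "\<dots> \<le> C' / a"
          proof -
            have "C * real a \<le> C' * (real a - 1)"
            proof -
              have "C' * (real a - 1) - C * real a = (r + 2) * (real a - 1) - C"
                using C(2) by (simp add: algebra_simps)
              also have "\<dots> \<ge> (r + 2) * (real r + 1) - C"
                using a by (intro diff_right_mono mult_left_mono) auto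
              also have "(r + 2) * (real r + 1) - C = C"
                by (simp add: C_def field_simps)
              finally show ?thesis using C(1) by simp
            qed
            then show ?thesis using a by (simp add: field_simps of_nat_diff)
          qed
          finally show ?thesis
            using \<rho>_eq[OF \<pi>] inv q(1) Suc.prems(2) by auto
        qed
        then have "(\<Sum>\<pi>\<in>?S. \<rho> (path_chain n 0 \<pi> v)) \<le> real (card ?S) * (C' / a)"
          by (rule sum_bounded_above)
        then show ?thesis by (simp add: mult.commute)
      next
        case False
        define L where "L = {\<pi>\<in>?S. inv \<pi> v \<le> Suc r}"
        define w where "w = C / real (a - 2)"
        have "L = (\<Union>q\<le>Suc r. {\<pi>\<in>?S. \<pi> q = v})"
          by (auto simp: L_def agreeing_def permutes_inv_eq permutes_inverses)
        also have "card \<dots> = (\<Sum>q\<le>Suc r. card {\<pi>\<in>?S. \<pi> q = v})"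
        proof (rule card_UN_disjoint)
          show "\<forall>i\<in>{..Suc r}. \<forall>j\<in>{..Suc r}. i \<noteq> j \<longrightarrow> {\<pi>\<in>?S. \<pi> i = v} \<inter> {\<pi>\<in>?S. \<pi> j = v} = {}"
            by (auto simp: agreeing_def)
        qed auto
        also have "\<dots> = (\<Sum>q\<le>Suc r. fact (n - card D - 1))"
          using Suc.prems D False \<open>v < n\<close> by (intro sum.cong refl card_agreeing_at) auto
        finally have cardL: "real (card L) = (r + 2) * fact (a - 1)"
          by (simp add: a_def)
        have "(\<Sum>\<pi>\<in>?S. \<rho> (path_chain n 0 \<pi> v)) \<le> (\<Sum>\<pi>\<in>?S. if \<pi> \<in> L then 1 else w)"
        proof (rule sum_mono)
          fix \<pi> assume \<pi>: "\<pi> \<in> ?S"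
          define q where "q = inv \<pi> v"
          show "\<rho> (path_chain n 0 \<pi> v) \<le> (if \<pi> \<in> L then 1 else w)"
          proof (cases "q \<le> Suc r")
            case True
            then show ?thesis using \<pi> by (simp add: \<rho>_eq L_def q_def)
          next
            case q: False
            have perm: "\<pi> permutes {..<n}" using \<pi> by (simp add: agreeing_def)
            have "q < n" using \<open>v < n\<close> perm by (simp add: q_def)
            have "\<pi> q = v" using perm by (simp add: q_def permutes_inverses)
            then have "q \<notin> D" using False \<pi> by (auto simp: agreeing_def)
            have "insert q D \<union> {..Suc r} \<subseteq> {..<n}" "insert q D \<inter> {..Suc r} = {}"
              using Suc.prems(2,3) \<open>q < n\<close> q by auto
            then have "card (insert q D) + (r + 2) \<le> n"
              using card_mono[of "{..<n}" "insert q D \<union> {..Suc r}"]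
                card_Un_disjoint[of "insert q D" "{..Suc r}"] D(2) by simp
            then have a3: "a \<ge> r + 3"
              using \<open>q \<notin> D\<close> D(2) by (simp add: a_def)
            have "D \<union> {q, q - 1} = insert q (insert (q - 1) D)" by auto
            then have "card (D \<union> {q, q - 1}) \<le> card D + 2"
              using D(2) by (simp add: card_insert_if)
            then have "C / real (n - card (D \<union> {q, q - 1})) \<le> w"
              unfolding w_def using a3 C by (intro divide_left_mono) (auto simp: a_def)
            then show ?thesis using q \<rho>_eq[OF \<pi>] by (simp add: L_def q_def)
          qed
        qed
        also have "\<dots> = card L + (real (card ?S) - card L) * w"
        proof -
          have "L \<subseteq> ?S" by (auto simp: L_def)
          then have "?S \<inter> {\<pi>. \<pi> \<in> L} = L" "?S \<inter> - {\<pi>. \<pi> \<in> L} = ?S - L" "card L \<le> card ?S"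
            by (auto intro: card_mono)
          with \<open>L \<subseteq> ?S\<close> show ?thesis
            by (simp add: sum.If_cases card_Diff_subset finite_subset of_nat_diff)
        qed
        also have "\<dots> = fact (a - 1) * ((r + 2) + (real a - (r + 2)) * w)"
          by (simp add: cardL cardS algebra_simps)
        also have "\<dots> \<le> fact (a - 1) * C'"
        proof (intro mult_left_mono)
          have "(real a - (r + 2)) * w \<le> C"
          proof (cases "a = 2")
            case False
            then have "a > 2" using a by simp
            then have "(real a - (r + 2)) * w \<le> (real a - 2) * w"
              using C(1) by (intro mult_right_mono) (auto simp: w_def)
            also have "\<dots> = C" using \<open>a > 2\<close> by (simp add: w_def of_nat_diff)
            finally show ?thesis .
          qed (use C(1) in \<open>simp add: w_def\<close>)
          then show "(r + 2) + (real a - (r + 2)) * w \<le> C'" using C(2) by simp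
        qed simp
        also have "\<dots> = C' / a * card ?S"
          using a by (simp add: cardS)
        finally show ?thesis .
      qed
      ultimately show ?thesis by blast
    qed
  qed
  then show ?case by (simp add: C'_def a_def)
qed

section \<open>Three nodes\<close>

text \<open>The transposition makes \<open>c\<close> the last node of the path.\<close>

lemma win_bound_path3:
  "win_bound (\<lambda>(c, s). path_instance 3 s (Transposition.transpose c 2)) 1 ({..<3} \<times> {..<2}) (5 / 6)"
proof -
  let ?I = "\<lambda>(c, s). path_instance 3 s (Transposition.transpose c 2)" and ?S = "{..<3 :: nat} \<times> {..<2 :: nat}"
  have perm: "Transposition.transpose c 2 permutes {..<3}" if "c < 3" for c :: nat
    using that by (intro permutes_swap_id) auto
  have cardS: "card ?S = 6" by simp
  have miss: "card {i\<in>T. source (?I i) = x} < card T" if "finite T" "(c, 0) \<in> T" "(c, 1) \<in> T" for T c x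
  proof (rule psubset_card_mono[OF \<open>finite T\<close>])
    have "source (?I (c, 0)) \<noteq> source (?I (c, 1))" by (auto simp: transpose_eq_iff)
    then have "(c, 0) \<notin> {i\<in>T. source (?I i) = x} \<or> (c, 1) \<notin> {i\<in>T. source (?I i) = x}" by auto
    with that have "{i\<in>T. source (?I i) = x} \<noteq> T" by metis
    then show "{i\<in>T. source (?I i) = x} \<subset> T" by blast
  qed
  have guess: "card {i\<in>?S. source (?I i) = x} \<le> 5" for x
    using miss[of ?S 0 x] unfolding cardS by simp
  have "\<exists>\<rho>. (\<forall>f\<in>(\<lambda>i. chain (?I i) v) ` ?S. win_bound ?I 0 {i\<in>?S. chain (?I i) v = f} (\<rho> f)) \<and>
        (\<Sum>i\<in>?S. \<rho> (chain (?I i) v)) \<le> 5 / 6 * card ?S" for v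
  proof (cases "v < 3")
    case False
    then have "chain (?I i) v = None" for i by (simp add: path_chain_def split: prod.split)
    then show ?thesis
      using guess by (intro exI[of _ "\<lambda>_. 5 / 6"]) (auto simp: cardS)
  next
    case True
    define f0 where "f0 = Some (2 :: nat, Some (Transposition.transpose v 2 1))"
    have f0: "path_chain 3 s (Transposition.transpose c 2) v = f0 \<longleftrightarrow> c = v" if "c < 3" "s < 2" for c s
    proof
      assume "c = v"
      moreover have "Transposition.transpose v 2 2 = v" by simp
      ultimately show "path_chain 3 s (Transposition.transpose c 2) v = f0"
        using path_chain_perm[OF perm[OF True], of s 2] that by (simp add: f0_def)
    next
      assume "path_chain 3 s (Transposition.transpose c 2) v = f0"
      then have "inv (Transposition.transpose c 2) v = 2"
        using True by (auto simp: path_chain_def f0_def Let_def max_def split: if_splits)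
      then have "Transposition.transpose c 2 2 = v"
        using permutes_inv_eq[OF perm[OF that(1)], of v 2] by blast
      then show "c = v" by simp
    qed
    define \<rho> where "\<rho> f = (if f = f0 then 1 / 2 else 1 :: real)" for f
    have "win_bound ?I 0 {i\<in>?S. chain (?I i) v = f} (\<rho> f)" for f
    proof (cases "f = f0")
      case True
      have eq: "{i\<in>?S. chain (?I i) v = f0} = {v} \<times> {..<2}"
      proof (intro set_eqI)
        fix i show "i \<in> {i\<in>?S. chain (?I i) v = f0} \<longleftrightarrow> i \<in> {v} \<times> {..<2}"
          using f0[of "fst i" "snd i"] \<open>v < 3\<close> by (cases i) auto
      qed
      have "card {i\<in>{v} \<times> {..<2}. source (?I i) = x} \<le> 1" for x
        using miss[of "{v} \<times> {..<2}" v x] by simp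
      then show ?thesis unfolding True eq by (simp add: \<rho>_def)
    next
      case False
      then show ?thesis by (simp only: \<rho>_def if_False) (rule win_bound_one, simp)
    qed
    moreover have "(\<Sum>i\<in>?S. \<rho> (chain (?I i) v)) = (\<Sum>i\<in>?S. if fst i = v then 1 / 2 else 1)"
    proof (rule sum.cong)
      fix i assume "i \<in> ?S"
      then show "\<rho> (chain (?I i) v) = (if fst i = v then 1 / 2 else 1)"
        using f0[of "fst i" "snd i"] by (cases i) (simp add: \<rho>_def)
    qed simp
    moreover have "\<dots> = (\<Sum>c<3. \<Sum>s<2::nat. if c = v then 1 / 2 else 1)"
      by (subst sum.cartesian_product) (auto intro: sum.cong)
    moreover have "\<dots> = 5"
    proof -
      have "v = 0 \<or> v = 1 \<or> v = 2" using True by auto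
      then show ?thesis by (auto simp: numeral_3_eq_3 numeral_2_eq_2)
    qed
    ultimately show ?thesis by (intro exI[of _ \<rho>]) (auto simp: cardS)
  qed
  then show ?thesis using guess by (simp only: One_nat_def win_bound.simps cardS) auto
qed

section \<open>The lower bound\<close>

lemma price_of_detection_less:
  assumes "price_of_detection A I < ereal (real (card (infected_nodes I)) * b)"
  shows "None \<notin> set_pmf (play A I [])"
    and "Some (x, h) \<in> set_pmf (play A I []) \<Longrightarrow> real (length h) < b"
proof -
  have less: "play_price I y < ereal (real (card (infected_nodes I)) * b)" if "y \<in> set_pmf (play A I [])" for y
    using assms SUP_upper[OF that, of "play_price I"] unfolding price_of_detection_def by simp
  from less[of None] show "None \<notin> set_pmf (play A I [])" by auto
  show "real (length h) < b" if "Some (x, h) \<in> set_pmf (play A I [])"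
    using less[OF that] by (auto simp: sum_list_triv mult.commute mult_less_cancel_right)
qed

lemma price_of_detection_ge: "price_of_detection A I \<ge> card (infected_nodes I)"
proof (rule ccontr)
  assume "\<not> ?thesis"
  then have less: "price_of_detection A I < ereal (real (card (infected_nodes I)) * 1)" by simp
  obtain y where y: "y \<in> set_pmf (play A I [])"
    using set_pmf_not_empty[of "play A I []"] by blast
  with price_of_detection_less(1)[OF less] obtain x h where "y = Some (x, h)"
    by (cases y) auto
  with y price_of_detection_less(2)[OF less, of x h] play_extends_history[of x h A I "[]"]
  show False by auto
qed

lemma success_le_win_bound:
  assumes "win_bound I k S \<beta>" "finite S" "S \<noteq> {}"
    and "\<And>i. i \<in> S \<Longrightarrow> sd_tree_instance (I i)" "solves_sd_on_trees A p"
    and "\<And>i. i \<in> S \<Longrightarrow> verts (graph (I i)) = V"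
    and "\<And>i. i \<in> S \<Longrightarrow> lifetime (graph (I i)) = T"
    and "\<And>i. i \<in> S \<Longrightarrow> duration (I i) = \<delta>"
    and price: "\<And>i. i \<in> S \<Longrightarrow>
      price_of_detection A (I i) < ereal (real (card (infected_nodes (I i))) * (real k + 1))"
  shows "p \<le> \<beta>"
proof -
  have "p * card S = (\<Sum>i\<in>S. p)" by simp
  also have "\<dots> \<le> (\<Sum>i\<in>S. success_prob A (I i))"
    using assms(4,5) by (intro sum_mono) (auto simp: solves_sd_on_trees_def)
  also have "\<dots> \<le> \<beta> * card S"
    unfolding success_prob_def
  proof (rule sum_success_le[OF assms(1,2,6,7,8)])
    fix i x h' assume "i \<in> S" "Some (x, h') \<in> set_pmf (play A (I i) [])"
    then have "real (length h') < real k + 1"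
      using price_of_detection_less(2)[OF price] by blast
    then show "length h' \<le> length [] + k" by simp
  qed (use price_of_detection_less(1)[OF price] in auto)
  finally show ?thesis
    using assms(2,3) by (simp add: card_gt_0_iff)
qed

lemma one_minus_exp_ge:
  fixes x :: real
  assumes "0 \<le> x"
  shows "x - x\<^sup>2 / 2 \<le> 1 - exp (- x)"
proof -
  have "1 \<le> 1 + x ^ 4 / 4" by simp
  also have "\<dots> = (1 - x + x\<^sup>2 / 2) * (1 + x + x\<^sup>2 / 2)"
    by (simp add: field_simps power2_eq_square power4_eq_xxxx)
  also have "\<dots> \<le> (1 - x + x\<^sup>2 / 2) * exp x"
  proof (rule mult_left_mono[OF exp_lower_Taylor_quadratic[OF assms]])
    have "0 \<le> ((x - 1)\<^sup>2 + 1) / 2" by simp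
    also have "\<dots> = 1 - x + x\<^sup>2 / 2" by (simp add: field_simps power2_eq_square)
    finally show "0 \<le> 1 - x + x\<^sup>2 / 2" .
  qed
  finally have "exp (- x) \<le> 1 - x + x\<^sup>2 / 2"
    by (simp add: exp_minus field_simps)
  then show ?thesis by simp
qed

lemma success_gt_of_few_rounds:
  fixes p \<epsilon> :: real and k n :: nat
  defines "x \<equiv> 2 * (real k)\<^sup>2 / real n"
  assumes "0 < \<epsilon>" "0 < p" "p \<le> 1" "0 < n"
    and k: "real k < 1 / 2 * sqrt (ln ((1 - p / (2 + \<epsilon>)) powi (-2))) * sqrt n"
  shows "x < 1" and "2 * x - x\<^sup>2 < p"
proof -
  define q where "q = p / (2 + \<epsilon>)"
  have q: "0 < q" "q < 1 / 2" "2 * q < p"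
    using assms by (auto simp: q_def field_simps mult_pos_pos)
  have ln: "ln ((1 - q) powi (-2)) = - 2 * ln (1 - q)"
    using q by (simp add: power_int_minus ln_inverse ln_realpow)
  have "ln (1 - q) < 0" using q by simp
  have "(real k)\<^sup>2 < (1 / 2 * sqrt (- 2 * ln (1 - q)) * sqrt n)\<^sup>2"
    using k ln unfolding q_def by (intro power_strict_mono) auto
  also have "\<dots> = - ln (1 - q) / 2 * n"
    using \<open>ln (1 - q) < 0\<close> by (simp add: power_mult_distrib power_divide)
  finally have x: "x < - ln (1 - q)"
    using \<open>0 < n\<close> by (simp add: x_def field_simps)
  also have "- ln (1 - q) \<le> ln 2"
    using q by (simp flip: ln_inverse add: field_simps)
  finally show "x < 1" using ln2_le_25_over_36 by linarith
  have "exp (ln (1 - q)) < exp (- x)" using x by (subst exp_less_cancel_iff) simp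
  then have "1 - q < exp (- x)" using q by simp
  moreover have "0 \<le> x" by (simp add: x_def)
  ultimately show "2 * x - x\<^sup>2 < p"
    using one_minus_exp_ge[of x] q by simp
qed

theorem theorem2:
  fixes \<epsilon> p :: real and A :: discoverer and n :: nat
  assumes "0 < \<epsilon>" and "\<epsilon> < 1"
    and "p > 0"
    and "solves_sd_on_trees A p"
    and "n \<ge> 1"
  shows "\<exists>I. sd_tree_instance I \<and> card (verts (graph I)) = n \<and>
           price_of_detection A I \<ge>
             ereal (1 / 2 * sqrt (ln ((1 - p / (2 + \<epsilon>)) powi (-2))) * (real n * sqrt (real n)))"
proof (rule ccontr)
  define b where "b = 1 / 2 * sqrt (ln ((1 - p / (2 + \<epsilon>)) powi (-2))) * sqrt (real n)"
  assume "\<not> ?thesis"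
  then have cheap: "price_of_detection A (path_instance n s \<pi>) <
      ereal (real (card (infected_nodes (path_instance n s \<pi>))) * b)"
    if "\<pi> permutes {..<n}" "s \<le> 1" "s < n" for \<pi> s
    using sd_tree_instance_path[OF that] infected_nodes_path[OF that(1)]
    by (auto simp: b_def not_le algebra_simps)
  have id: "id permutes {..<n}" by (rule permutes_id)
  have "ereal (real n) < ereal (real n * b)"
    using order.strict_trans1[OF price_of_detection_ge[of "path_instance n 0 id" A] cheap[OF id]] \<open>n \<ge> 1\<close>
    unfolding infected_nodes_path[OF id] by simp
  then have "1 < b" using \<open>n \<ge> 1\<close> by simp
  define k where "k = nat \<lceil>b\<rceil> - 1"
  have k: "1 \<le> k" "real k < b" "b \<le> real k + 1"
    using \<open>1 < b\<close> unfolding k_def by linarith+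
  have cheap': "price_of_detection A (path_instance n s \<pi>) <
      ereal (real (card (infected_nodes (path_instance n s \<pi>))) * (real k + 1))"
    if "\<pi> permutes {..<n}" "s \<le> 1" "s < n" for \<pi> s
    using k(3) by (intro order.strict_trans2[OF cheap[OF that]]) (simp add: mult_left_mono)
  have "p \<le> success_prob A (path_instance n 0 id)"
    using assms(4,5) sd_tree_instance_path[OF id, of 0] by (simp add: solves_sd_on_trees_def)
  then have "p \<le> 1" by (simp add: success_prob_def pmf_le_1 order_trans)
  define x where "x = 2 * (real k)\<^sup>2 / real n"
  have x: "x < 1" "2 * x - x\<^sup>2 < p"
    using success_gt_of_few_rounds[of \<epsilon> p n k] assms k(2) \<open>p \<le> 1\<close> by (auto simp: x_def b_def)
  have "0 < x" using k(1) assms(5) by (simp add: x_def)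
  have "2 * (real k)\<^sup>2 < real n" using x(1) assms(5) by (simp add: x_def)
  then have kn: "2 * k\<^sup>2 < n" by (metis of_nat_less_iff of_nat_mult of_nat_numeral of_nat_power)
  have "k \<le> k\<^sup>2" by (simp add: power2_eq_square)
  with kn have "k < n" by linarith
  show False
  proof (cases "n = 3")
    case True
    have "k < 2"
    proof (rule ccontr)
      assume "\<not> k < 2"
      then have "2\<^sup>2 \<le> k\<^sup>2" by (intro power_mono) auto
      with kn True show False by simp
    qed
    then have "k = 1" using k(1) by simp
    have "p \<le> 5 / 6"
    proof (rule success_le_win_bound[OF win_bound_path3 _ _ _ assms(4)])
      fix i :: "nat \<times> nat" assume "i \<in> {..<3} \<times> {..<2}"
      then obtain c s where i: "i = (c, s)" "s < 2" "c < 3" by auto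
      then have \<pi>: "Transposition.transpose c 2 permutes {..<3}" by (intro permutes_swap_id) auto
      show "sd_tree_instance (case i of (c, s) \<Rightarrow> path_instance 3 s (Transposition.transpose c 2))"
        using sd_tree_instance_path[OF \<pi>, of s] i by simp
      show "price_of_detection A (case i of (c, s) \<Rightarrow> path_instance 3 s (Transposition.transpose c 2)) <
        ereal (real (card (infected_nodes (case i of (c, s) \<Rightarrow> path_instance 3 s (Transposition.transpose c 2)))) * (real 1 + 1))"
        using cheap'[of "Transposition.transpose c 2" s] \<pi> i True \<open>k = 1\<close> by simp
    next
      show "{..<3} \<times> {..<2} \<noteq> ({} :: (nat \<times> nat) set)" by (auto simp: lessThan_empty_iff)
    qed (auto split: prod.splits)
    moreover have "x = 2 / 3" using True \<open>k = 1\<close> by (simp add: x_def)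
    moreover from this have "2 * x - x\<^sup>2 = 8 / 9" by (simp only:) (simp add: power2_eq_square)
    ultimately show False using x(2) by linarith
  next
    case False
    have "p \<le> real ((k + 1) * (k + 2)) / 2 / real (n - card ({} :: nat set))"
    proof (rule success_le_win_bound[OF win_bound_path[OF id] _ _ _ assms(4)])
      show "agreeing n {} id \<noteq> {}" using id unfolding agreeing_def by blast
      fix \<pi> assume "\<pi> \<in> agreeing n {} id"
      then have \<pi>: "\<pi> permutes {..<n}" by (simp add: agreeing_def)
      show "sd_tree_instance (path_instance n 0 \<pi>)"
        using sd_tree_instance_path[OF \<pi>] assms(5) by simp
      show "price_of_detection A (path_instance n 0 \<pi>) <
          ereal (real (card (infected_nodes (path_instance n 0 \<pi>))) * (real k + 1))"
        using cheap'[OF \<pi>] assms(5) by simp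
    qed (use \<open>k < n\<close> in auto)
    then have p: "p \<le> real ((k + 1) * (k + 2)) / (2 * real n)" by simp
    show False
    proof (cases "k = 1")
      case True
      with kn False have "4 \<le> n" by simp
      then have "x \<le> 1 / 2" using True by (simp add: x_def field_simps)
      then have "x * x \<le> x * (1 / 2)" using \<open>0 < x\<close> by (intro mult_left_mono) auto
      moreover have "p \<le> 3 / 2 * x" using p True by (simp add: x_def)
      ultimately show False using x(2) by (simp add: power2_eq_square)
    next
      case False
      with k(1) have "2 \<le> real k" by simp
      then have "2 * real k \<le> real k * real k" by (intro mult_right_mono) auto
      moreover have "real ((k + 1) * (k + 2)) = real k * real k + 3 * real k + 2"
        by (simp add: algebra_simps)
      ultimately have "real ((k + 1) * (k + 2)) \<le> 3 * (real k)\<^sup>2"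
        using \<open>2 \<le> real k\<close> unfolding power2_eq_square by linarith
      then have "real ((k + 1) * (k + 2)) / (2 * real n) \<le> 3 * (real k)\<^sup>2 / (2 * real n)"
        by (intro divide_right_mono) auto
      also have "\<dots> = 3 / 4 * x" by (simp add: x_def)
      finally have "p \<le> 3 / 4 * x" using p by linarith
      moreover have "x * x \<le> x * 1" using \<open>0 < x\<close> x(1) by (intro mult_left_mono) auto
      ultimately show False using x(2) \<open>0 < x\<close> unfolding power2_eq_square by linarith
    qed
  qed
qed

end
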